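(* Let $n\ge2$ be an integer, $D_a>0$, $L>0$. $\alpha$) For all $\gamma<0$, $$\mathcal{F}^{(n)}\subseteq\mathcal{E}^{(n)}\quad\text{and}\quad\mathcal{F}^{(n)}\setminus\mathbb{R}^n_-\ne\emptyset,$$ where, with $\lambda_1^{(n)}<\lambda_2^{(n)}<\dots<\lambda_n^{(n)}$ the eigenvalues (in increasing order) and $v_1^{(n)},\dots,v_n^{(n)}$ the corresponding normalized eigenvectors of $S^{(n)}A_\gamma^{(n)}S^{(n)}$, $$\mathcal{E}^{(n)}:=\Big\{e\in\mathbb{R}^n:\ \forall t\ge0,\ \Big(\sum_{i=1}^n\exp(\lambda_i^{(n)}t)\,(v_i^{(n)})_1\,v_i^{(n)}\Big)^{\!\top}e\le0\Big\},$$ and $\mathcal{F}^{(n)}$ is the polyhedral cone $$\mathcal{F}^{(n)}:=\{e\in\mathbb{R}^n:-{P^{(n)}}^{\top}e\in\mathbb{R}^n_+\}=\{-({P^{(n)}}^{\top})^{-1}a:a\in\mathbb{R}^n_+\},$$ where $P^{(n)}:=(p_1^{(n)}\ \cdots\ p_n^{(n)})\in\mathbb{R}^{n\times n}$ is the matrix with columns $$p_i^{(n)}:=\sum_{k=i}^n\Big[\prod_{j=1}^{i-1}\Big(1-\frac{\lambda_k^{(n)}}{\lambda_j^{(n)}}\Big)\Big](v_k^{(n)})_1\,v_k^{(n)},\qquad i=1,\dots,n.$$ $\beta$) For all $\kappa<0$ and $\gamma<0$ with $\kappa\ne\gamma$, and for every $e_0\in\mathcal{F}^{(n)}\cup\mathbb{R}^n_-$,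 the component $x^{(n)}$ of the solution of the system $$\dot x^{(n)}(t)=A_\kappa^{(n)}x^{(n)}(t)+\kappa p_1\mathbf{e}_1\mathbf{e}_1^\top e^{(n)}(t),\qquad \dot e^{(n)}(t)=S^{(n)}A_\gamma^{(n)}S^{(n)}e^{(n)}(t),$$ with initial condition $x^{(n)}(0)=x_0$, $e^{(n)}(0)=e_0$, satisfies $x^{(n)}(t)\ge0$ for all $t\ge0$, for all $x_0\in\mathbb{R}^n_+$.
   Context: Let $\Delta z=L/(n-1)$, $p_1=D_a(\Delta z)^{-1}$, $p_2=D_a(\Delta z)^{-2}$. (The scalar $p_1$ is not to be confused with the vectors $p_i^{(n)}$.) $A^{(n)}\in\mathbb{R}^{n\times n}$ is the symmetric tridiagonal matrix whose sub- and super-diagonal entries all equal $p_2$, whose first and last diagonal entries equal $-p_2$, and whose other diagonal entries equal $-2p_2$. For $\eta\in\mathbb{R}$, $A_\eta^{(n)}:=A^{(n)}+\eta p_1\mathbf{e}_1\mathbf{e}_1^\top$, where $\mathbf{e}_1$ is the first canonical basis vector of $\mathbb{R}^n$. $S^{(n)}$ is the $n\times n$ permutation matrix with $1$'s on the anti-diagonal and $0$'s elsewhere. $(v)_1$ denotes the first component of a vector $v$. $\mathbb{R}^n_+$ (resp. $\mathbb{R}^n_-$) is the cone of vectors with all components $\ge0$ (resp. $\le0$), and $x\ge0$ means $x\in\mathbb{R}^n_+$. Normalized means of unit Euclidean norm. An empty product equals $1$. *)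

theory Defs
  imports Complex_Main "Jordan_Normal_Form.Spectral_Radius"
begin

text \<open>
  All indices are shifted by one with respect to the informal statement: matrix rows and columns,
  vector components, eigenvalues and eigenvectors are numbered \<open>0, \<dots>, n - 1\<close>.
  In particular the first component of \<open>v\<close> is \<open>v $ 0\<close>.
\<close>

definition grid_step :: "nat \<Rightarrow> real \<Rightarrow> real" where
  "grid_step n L = L / (real n - 1)"

definition coef1 :: "nat \<Rightarrow> real \<Rightarrow> real \<Rightarrow> real" where
  "coef1 n Da L = Da / grid_step n L"

definition coef2 :: "nat \<Rightarrow> real \<Rightarrow> real \<Rightarrow> real" where
  "coef2 n Da L = Da / (grid_step n L)\<^sup>2"

definition A_mat :: "nat \<Rightarrow> real \<Rightarrow> real \<Rightarrow> real mat" where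
  "A_mat n Da L = mat n n (\<lambda>(i, j).
     if i = j then (if i = 0 \<or> i = n - 1 then - coef2 n Da L else - 2 * coef2 n Da L)
     else if i = Suc j \<or> j = Suc i then coef2 n Da L
     else 0)"

definition e1e1T :: "nat \<Rightarrow> real mat" where
  "e1e1T n = mat n n (\<lambda>(i, j). unit_vec n 0 $ i * unit_vec n 0 $ j)"

definition A_eta :: "nat \<Rightarrow> real \<Rightarrow> real \<Rightarrow> real \<Rightarrow> real mat" where
  "A_eta n Da L \<eta> = A_mat n Da L + (\<eta> * coef1 n Da L) \<cdot>\<^sub>m e1e1T n"

definition S_mat :: "nat \<Rightarrow> real mat" where
  "S_mat n = mat n n (\<lambda>(i, j). if i + j = n - 1 then 1 else 0)"

definition error_mat :: "nat \<Rightarrow> real \<Rightarrow> real \<Rightarrow> real \<Rightarrow> real mat" where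
  "error_mat n Da L \<gamma> = S_mat n * A_eta n Da L \<gamma> * S_mat n"

text \<open>The order on vectors is componentwise and relates only vectors of equal dimension.\<close>

definition nonneg_cone :: "nat \<Rightarrow> real vec set" where
  "nonneg_cone n = {x. 0\<^sub>v n \<le> x}"

definition nonpos_cone :: "nat \<Rightarrow> real vec set" where
  "nonpos_cone n = {x. x \<le> 0\<^sub>v n}"

definition ordered_eigensystem ::
    "nat \<Rightarrow> real mat \<Rightarrow> (nat \<Rightarrow> real) \<Rightarrow> (nat \<Rightarrow> real vec) \<Rightarrow> bool" where
  "ordered_eigensystem n M lam v \<longleftrightarrow>
     strict_mono_on {..<n} lam \<and> spectrum M = lam ` {..<n} \<and>
     (\<forall>k<n. eigenvector M (v k) (lam k) \<and> sqrt (v k \<bullet> v k) = 1)"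

definition E_set :: "nat \<Rightarrow> (nat \<Rightarrow> real) \<Rightarrow> (nat \<Rightarrow> real vec) \<Rightarrow> real vec set" where
  "E_set n lam v = {e \<in> carrier_vec n. \<forall>t\<ge>0.
     vec n (\<lambda>r. \<Sum>i<n. exp (lam i * t) * v i $ 0 * v i $ r) \<bullet> e \<le> 0}"

definition p_vec :: "nat \<Rightarrow> (nat \<Rightarrow> real) \<Rightarrow> (nat \<Rightarrow> real vec) \<Rightarrow> nat \<Rightarrow> real vec" where
  "p_vec n lam v i = vec n (\<lambda>r.
     \<Sum>k=i..<n. (\<Prod>j<i. 1 - lam k / lam j) * v k $ 0 * v k $ r)"

definition P_mat :: "nat \<Rightarrow> (nat \<Rightarrow> real) \<Rightarrow> (nat \<Rightarrow> real vec) \<Rightarrow> real mat" where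
  "P_mat n lam v = mat_of_cols n (map (p_vec n lam v) [0..<n])"

definition F_set :: "nat \<Rightarrow> (nat \<Rightarrow> real) \<Rightarrow> (nat \<Rightarrow> real vec) \<Rightarrow> real vec set" where
  "F_set n lam v = {e \<in> carrier_vec n. - (P_mat n lam v)\<^sup>T *\<^sub>v e \<in> nonneg_cone n}"

text \<open>
  Derivatives are taken componentwise, and one-sided at time 0.
\<close>

definition vec_has_derivative_on_halfline ::
    "nat \<Rightarrow> (real \<Rightarrow> real vec) \<Rightarrow> (real \<Rightarrow> real vec) \<Rightarrow> bool" where
  "vec_has_derivative_on_halfline n x x' \<longleftrightarrow>
     (\<forall>t\<ge>0. x t \<in> carrier_vec n \<and>
       (\<forall>i<n. ((\<lambda>s. x s $ i) has_real_derivative x' t $ i) (at t within {0..})))"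

definition solves_system ::
    "nat \<Rightarrow> real \<Rightarrow> real \<Rightarrow> real \<Rightarrow> real \<Rightarrow> real vec \<Rightarrow> real vec \<Rightarrow>
     (real \<Rightarrow> real vec) \<Rightarrow> (real \<Rightarrow> real vec) \<Rightarrow> bool" where
  "solves_system n Da L \<kappa> \<gamma> x0 e0 x e \<longleftrightarrow>
     vec_has_derivative_on_halfline n x
       (\<lambda>t. A_eta n Da L \<kappa> *\<^sub>v x t + ((\<kappa> * coef1 n Da L) \<cdot>\<^sub>m e1e1T n) *\<^sub>v e t) \<and>
     vec_has_derivative_on_halfline n e (\<lambda>t. error_mat n Da L \<gamma> *\<^sub>v e t) \<and>
     x 0 = x0 \<and> e 0 = e0"

end

theory Submission
  imports Defs
begin

text \<open>
  The matrix \<open>M = error_mat n Da L \<gamma>\<close> is a Jacobi matrix, so its eigenvalues are the roots of a polynomial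
  given by a three-term recurrence; the Christoffel--Darboux identities show that these roots are
  real and simple, and \<open>\<gamma> < 0\<close> makes them negative.

  For \<open>e \<in> F_set\<close>, the function \<open>f t\<close> that has to be nonpositive is a sum of exponentials
  \<open>exp (lam k * t)\<close>. The columns of \<open>P_mat\<close> are chosen such that their scalar products with \<open>e\<close> are the
  values at 0 of \<open>h i = (1 - D / lam 0) \<cdots> (1 - D / lam (i - 1)) f\<close>. As
  \<open>h i' = lam i * h i - lam i * h (i + 1)\<close>, \<open>lam i < 0\<close> and \<open>h n = 0\<close>, the sign propagates from \<open>i = n\<close> down
  to \<open>h 0 = f\<close>. Since \<open>f t\<close> is the first component of \<open>exp (t M) e\<close>, it makes the inhomogeneous term of the
  equation for \<open>x\<close> nonnegative, and a linear system with nonnegative off-diagonal coefficients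
  preserves the orthant.

  Moreover \<open>P_mat\<close> is upper triangular with positive diagonal, as its columns arise from the first
  unit vector by successive application of \<open>I - M / lam i\<close>.
\<close>

subsection \<open>Jacobi matrices and their orthogonal polynomials\<close>

definition jacobi_mat :: "nat \<Rightarrow> (nat \<Rightarrow> 'a) \<Rightarrow> 'a \<Rightarrow> 'a::field mat" where
  "jacobi_mat n a b = mat n n (\<lambda>(i, j).
     if i = j then a i else if i = Suc j \<or> j = Suc i then b else 0)"

text \<open>For nonzero \<open>b\<close>, \<open>jacobi_poly a b i\<close> is the characteristic
  polynomial of the leading \<open>i\<close> by \<open>i\<close> block of \<open>jacobi_mat\<close>,
  divided by the \<open>i\<close>-th power of \<open>b\<close>. With this scaling the values at an
  eigenvalue are the components of the eigenvector with first component 1. The field is kept general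
  because the roots are studied over the complex numbers.\<close>

fun jacobi_poly :: "(nat \<Rightarrow> 'a) \<Rightarrow> 'a \<Rightarrow> nat \<Rightarrow> 'a::field poly" where
  "jacobi_poly a b 0 = 1"
| "jacobi_poly a b (Suc 0) = Polynomial.smult (1 / b) [:- a 0, 1:]"
| "jacobi_poly a b (Suc (Suc i)) =
     Polynomial.smult (1 / b) ([:- a (Suc i), 1:] * jacobi_poly a b (Suc i)) - jacobi_poly a b i"

lemma jacobi_mat_carrier [simp]: "jacobi_mat n a b \<in> carrier_mat n n"
  by (simp add: jacobi_mat_def)

lemma jacobi_mat_dim [simp]: "dim_row (jacobi_mat n a b) = n" "dim_col (jacobi_mat n a b) = n"
  by (simp_all add: jacobi_mat_def)

lemma transpose_jacobi_mat [simp]: "(jacobi_mat n a b)\<^sup>T = jacobi_mat n a b"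
  by (rule eq_matI) (auto simp: jacobi_mat_def)

lemma jacobi_mat_mult_vec_index:
  assumes "w \<in> carrier_vec n" "i < n"
  shows "(jacobi_mat n a b *\<^sub>v w) $ i =
    a i * w $ i + (if 0 < i then b * w $ (i - 1) else 0)
      + (if Suc i < n then b * w $ Suc i else 0)"
proof -
  have "(jacobi_mat n a b *\<^sub>v w) $ i =
      (\<Sum>j<n. (if i = j then a i else if i = Suc j \<or> j = Suc i then b else 0) * w $ j)"
    using assms by (auto simp: jacobi_mat_def scalar_prod_def atLeast0LessThan intro!: sum.cong)
  also have "\<dots> = (\<Sum>j<n. (if j = i then a i * w $ i else 0)
      + (if j = i - 1 then (if 0 < i then b * w $ (i - 1) else 0) else 0)
      + (if j = Suc i then b * w $ Suc i else 0))"
    by (rule sum.cong) auto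
  also have "\<dots> = a i * w $ i + (if 0 < i then b * w $ (i - 1) else 0)
      + (if Suc i < n then b * w $ Suc i else 0)"
    using assms by (simp add: sum.distrib sum.delta less_imp_diff_less)
  finally show ?thesis .
qed

text \<open>As \<open>b\<close> is nonzero, row \<open>i\<close> determines \<open>u (Suc i)\<close>
  from the earlier values, so \<open>u 0\<close> fixes everything. The last row still contains
  \<open>u n\<close>; the boundary condition there is imposed separately.\<close>

lemma jacobi_recurrence_iff:
  fixes b :: "'a::field"
  assumes "b \<noteq> 0"
  shows "(\<forall>i<n. a i * u i + (if 0 < i then b * u (i - 1) else 0) + b * u (Suc i) = x * u i)
    \<longleftrightarrow> (\<forall>i\<le>n. u i = u 0 * poly (jacobi_poly a b i) x)" (is "(\<forall>i<n. ?L i) \<longleftrightarrow> (\<forall>i\<le>n. ?R i)")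
proof (induction n)
  case 0
  then show ?case by simp
next
  case (Suc n)
  have "?L n \<longleftrightarrow> ?R (Suc n)" if R: "\<forall>i\<le>n. ?R i"
  proof (cases n)
    case 0
    then show ?thesis using assms by (auto simp: field_simps)
  next
    case (Suc m)
    have "?R n" "?R m" using R Suc by (blast intro: le_refl, metis le_SucI le_refl)
    then show ?thesis using assms Suc by (auto simp: field_simps)
  qed
  moreover have "(\<forall>i<Suc n. ?L i) \<longleftrightarrow> (\<forall>i<n. ?L i) \<and> ?L n"
    unfolding less_Suc_eq by blast
  moreover have "(\<forall>i\<le>Suc n. ?R i) \<longleftrightarrow> (\<forall>i\<le>n. ?R i) \<and> ?R (Suc n)"
    unfolding le_Suc_eq by blast
  ultimately show ?case using Suc.IH by argo
qed

lemma jacobi_eigen_iff: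
  fixes b :: "'a::field"
  assumes "b \<noteq> 0" "0 < n" "w \<in> carrier_vec n"
  shows "jacobi_mat n a b *\<^sub>v w = x \<cdot>\<^sub>v w \<longleftrightarrow>
    (\<forall>i<n. w $ i = w $ 0 * poly (jacobi_poly a b i) x) \<and>
    w $ 0 * poly (jacobi_poly a b n) x = 0"
proof -
  \<comment> \<open>Padding with \<open>u n = 0\<close> gives the last row the same shape as the
    others. The formula for \<open>u n\<close> then becomes the condition that \<open>x\<close> is a
    root, unless \<open>w $ 0\<close> vanishes.\<close>
  define u where "u i = (if i < n then w $ i else 0)" for i
  have u: "u 0 = w $ 0" "u n = 0" "\<And>i. i < n \<Longrightarrow> u i = w $ i"
    using assms by (auto simp: u_def)
  have "jacobi_mat n a b *\<^sub>v w = x \<cdot>\<^sub>v w \<longleftrightarrow>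
      (\<forall>i<n. (jacobi_mat n a b *\<^sub>v w) $ i = x * w $ i)"
    using assms by (auto simp: vec_eq_iff)
  also have "\<dots> \<longleftrightarrow>
      (\<forall>i<n. a i * u i + (if 0 < i then b * u (i - 1) else 0) + b * u (Suc i) = x * u i)"
  proof (intro all_cong1 imp_cong refl)
    fix i assume "i < n"
    then show "(jacobi_mat n a b *\<^sub>v w) $ i = x * w $ i \<longleftrightarrow>
        a i * u i + (if 0 < i then b * u (i - 1) else 0) + b * u (Suc i) = x * u i"
      unfolding jacobi_mat_mult_vec_index[OF assms(3) \<open>i < n\<close>] by (auto simp: u_def)
  qed
  also have "\<dots> \<longleftrightarrow> (\<forall>i\<le>n. u i = u 0 * poly (jacobi_poly a b i) x)"
    by (rule jacobi_recurrence_iff) fact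
  also have "\<dots> \<longleftrightarrow> (\<forall>i<n. u i = u 0 * poly (jacobi_poly a b i) x) \<and>
      u n = u 0 * poly (jacobi_poly a b n) x"
    unfolding le_less by blast
  also have "\<dots> \<longleftrightarrow> (\<forall>i<n. w $ i = w $ 0 * poly (jacobi_poly a b i) x) \<and>
      w $ 0 * poly (jacobi_poly a b n) x = 0"
    unfolding u(1,2) using u(3) by (metis (no_types))
  finally show ?thesis .
qed

lemma jacobi_eigenvector_iff:
  fixes b :: "'a::field"
  assumes "b \<noteq> 0" "0 < n" "w \<in> carrier_vec n"
  shows "eigenvector (jacobi_mat n a b) w x \<longleftrightarrow> w $ 0 \<noteq> 0 \<and>
    (\<forall>i<n. w $ i = w $ 0 * poly (jacobi_poly a b i) x) \<and> poly (jacobi_poly a b n) x = 0"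
proof -
  have "w = 0\<^sub>v n \<longleftrightarrow> w $ 0 = 0" if w: "\<forall>i<n. w $ i = w $ 0 * poly (jacobi_poly a b i) x"
  proof
    assume "w $ 0 = 0"
    have "w $ i = 0" if "i < n" for i
      using w[rule_format, OF that] unfolding \<open>w $ 0 = 0\<close> by simp
    then show "w = 0\<^sub>v n" using assms by auto
  qed (use assms in auto)
  moreover have "eigenvector (jacobi_mat n a b) w x \<longleftrightarrow>
      w \<noteq> 0\<^sub>v n \<and> jacobi_mat n a b *\<^sub>v w = x \<cdot>\<^sub>v w"
    using assms(3) by (simp add: eigenvector_def)
  ultimately show ?thesis
    unfolding jacobi_eigen_iff[OF assms] mult_eq_0_iff by blast
qed

lemma jacobi_eigenvectorD:
  fixes b :: "'a::field"
  assumes "b \<noteq> 0" "0 < n" "eigenvector (jacobi_mat n a b) w x"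
  shows "w $ 0 \<noteq> 0" "poly (jacobi_poly a b n) x = 0"
proof -
  have "w \<in> carrier_vec n" using assms(3) by (simp add: eigenvector_def)
  then show "w $ 0 \<noteq> 0" "poly (jacobi_poly a b n) x = 0"
    using jacobi_eigenvector_iff[OF assms(1,2)] assms(3) by blast+
qed

section \<open>Degree, Christoffel-Darboux identities, and real simple roots\<close>

lemma degree_jacobi_poly:
  fixes b :: "'a::field"
  assumes "b \<noteq> 0"
  shows "degree (jacobi_poly a b i) = i"
proof (induction i rule: induct_nat_012)
  case (ge2 i)
  then have "degree ([:- a (Suc i), 1:] * jacobi_poly a b (Suc i)) = Suc (Suc i)"
    by (subst degree_mult_eq) auto
  then show ?case
    using ge2 assms by (simp del: mult_pCons_left add: degree_add_eq_left flip: add_uminus_conv_diff)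
qed (use assms in auto)

text \<open>The left side is antisymmetric in \<open>x\<close> and \<open>y\<close>, so the diagonal
  coefficient \<open>a (Suc k)\<close> cancels and the induction step contributes exactly one new
  summand. The choice \<open>y = cnj x\<close> excludes nonreal roots.\<close>

lemma christoffel_darboux:
  fixes b :: "'a::field"
  assumes "b \<noteq> 0"
  shows "b * (poly (jacobi_poly a b (Suc k)) x * poly (jacobi_poly a b k) y
        - poly (jacobi_poly a b k) x * poly (jacobi_poly a b (Suc k)) y)
    = (x - y) * (\<Sum>j\<le>k. poly (jacobi_poly a b j) x * poly (jacobi_poly a b j) y)"
proof (induction k)
  case 0
  then show ?case using assms by (simp add: field_simps)
next
  case (Suc k)
  have rec: "b * poly (jacobi_poly a b (Suc (Suc k))) z =
      (z - a (Suc k)) * poly (jacobi_poly a b (Suc k)) z - b * poly (jacobi_poly a b k) z" for z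
    using assms by (simp add: field_simps)
  let ?p = "\<lambda>i. poly (jacobi_poly a b i)"
  have "b * (?p (Suc (Suc k)) x * ?p (Suc k) y - ?p (Suc k) x * ?p (Suc (Suc k)) y) =
      (b * ?p (Suc (Suc k)) x) * ?p (Suc k) y - ?p (Suc k) x * (b * ?p (Suc (Suc k)) y)"
    by (simp only: algebra_simps)
  also have "\<dots> = (x - y) * (?p (Suc k) x * ?p (Suc k) y)
      + b * (?p (Suc k) x * ?p k y - ?p k x * ?p (Suc k) y)"
    unfolding rec by (simp only: algebra_simps)
  finally show ?case
    unfolding Suc.IH by (simp only: sum.atMost_Suc distrib_left add.commute)
qed

text \<open>This is the limit of the preceding identity as \<open>y\<close> tends to
  \<open>x\<close>, obtained here by differentiating the recurrence. It excludes multiple roots: at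
  such a root the left side is zero.\<close>

lemma christoffel_darboux_confluent:
  fixes b :: "'a::field_char_0"
  assumes "b \<noteq> 0"
  shows "b * (poly (pderiv (jacobi_poly a b (Suc k))) x * poly (jacobi_poly a b k) x
        - poly (pderiv (jacobi_poly a b k)) x * poly (jacobi_poly a b (Suc k)) x)
    = (\<Sum>j\<le>k. (poly (jacobi_poly a b j) x)\<^sup>2)"
proof (induction k)
  case 0
  then show ?case using assms by (simp add: field_simps pderiv_smult pderiv_pCons)
next
  case (Suc k)
  let ?p = "\<lambda>i. poly (jacobi_poly a b i) x"
  let ?d = "\<lambda>i. poly (pderiv (jacobi_poly a b i)) x"
  have p: "b * ?p (Suc (Suc k)) = (x - a (Suc k)) * ?p (Suc k) - b * ?p k"
    using assms by (simp add: field_simps)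
  have d: "b * ?d (Suc (Suc k)) = ?p (Suc k) + (x - a (Suc k)) * ?d (Suc k) - b * ?d k"
    using assms
    by (simp del: mult_pCons_left
        add: pderiv_smult pderiv_diff pderiv_mult pderiv_pCons right_diff_distrib)
  have "b * (?d (Suc (Suc k)) * ?p (Suc k) - ?d (Suc k) * ?p (Suc (Suc k))) =
      (b * ?d (Suc (Suc k))) * ?p (Suc k) - ?d (Suc k) * (b * ?p (Suc (Suc k)))"
    by (simp only: algebra_simps)
  also have "\<dots> = (?p (Suc k))\<^sup>2 + b * (?d (Suc k) * ?p k - ?d k * ?p (Suc k))"
    unfolding p d by (simp only: algebra_simps power2_eq_square)
  finally show ?case
    unfolding Suc.IH by (simp only: sum.atMost_Suc add.commute)
qed

lemma poly_jacobi_poly_of_real: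
  "poly (jacobi_poly (\<lambda>i. complex_of_real (a i)) (complex_of_real b) i) (complex_of_real x)
     = complex_of_real (poly (jacobi_poly a b i) x)"
  by (induction i rule: jacobi_poly.induct[of _ a b]) auto

lemma cnj_poly_jacobi_poly:
  "poly (jacobi_poly (\<lambda>i. complex_of_real (a i)) (complex_of_real b) i) (cnj z)
     = cnj (poly (jacobi_poly (\<lambda>i. complex_of_real (a i)) (complex_of_real b) i) z)"
  by (induction i rule: jacobi_poly.induct[of _ a b]) auto

text \<open>A squarefree complex polynomial of degree \<open>n\<close> has exactly \<open>n\<close>
  roots. It therefore suffices that every complex root is real and simple.\<close>

lemma card_roots_jacobi_poly:
  fixes b :: real
  assumes "b \<noteq> 0"
  shows "card {x. poly (jacobi_poly a b n) x = 0} = n"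
proof (cases n)
  case 0
  then show ?thesis by simp
next
  case (Suc m)
  define q where "q = jacobi_poly (\<lambda>i. complex_of_real (a i)) (complex_of_real b)"
  have b: "complex_of_real b \<noteq> 0" using assms by simp
  note deg = degree_jacobi_poly[OF b, of "\<lambda>i. complex_of_real (a i)", folded q_def]
  have real_root: "z \<in> \<real>" if z: "poly (q n) z = 0" for z
  proof -
    \<comment> \<open>The coefficients are real, so \<open>cnj z\<close> is a root too and the left
      side of the identity vanishes. The remaining sum is one of squared moduli, whose term for
      \<open>j = 0\<close> is 1.\<close>
    have "(z - cnj z) * (\<Sum>j\<le>m. poly (q j) z * poly (q j) (cnj z)) = 0"
      using christoffel_darboux[OF b, of "\<lambda>i. complex_of_real (a i)" m z "cnj z"] z
      unfolding q_def cnj_poly_jacobi_poly Suc by simp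
    moreover have "(\<Sum>j\<le>m. poly (q j) z * poly (q j) (cnj z)) \<noteq> 0"
    proof -
      have "(\<Sum>j\<le>m. poly (q j) z * poly (q j) (cnj z)) = of_real (\<Sum>j\<le>m. (cmod (poly (q j) z))\<^sup>2)"
        unfolding q_def cnj_poly_jacobi_poly of_real_sum complex_norm_square ..
      moreover have "(\<Sum>j\<le>m. (cmod (poly (q j) z))\<^sup>2) > 0"
        by (rule sum_pos2[of _ 0]) (auto simp: q_def)
      ultimately show ?thesis by (metis of_real_eq_0_iff less_irrefl)
    qed
    ultimately have "cnj z = z" by simp
    then show ?thesis by (simp add: complex_is_Real_iff complex_eq_iff)
  qed
  have simple: "poly (pderiv (q n)) z \<noteq> 0" if z: "poly (q n) z = 0" for z
  proof
    assume d: "poly (pderiv (q n)) z = 0"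
    \<comment> \<open>Reality has to come first: a sum of squares of complex numbers could vanish,
      one of real numbers with first term 1 cannot.\<close>
    obtain x where x: "z = complex_of_real x" using real_root[OF z] by (auto elim: Reals_cases)
    have "(\<Sum>j\<le>m. (poly (q j) z)\<^sup>2) = 0"
      using christoffel_darboux_confluent[OF b, of "\<lambda>i. complex_of_real (a i)" m z] z d
      unfolding q_def Suc by simp
    moreover have "(\<Sum>j\<le>m. (poly (q j) z)\<^sup>2) = of_real (\<Sum>j\<le>m. (poly (jacobi_poly a b j) x)\<^sup>2)"
      unfolding q_def x poly_jacobi_poly_of_real by simp
    moreover have "(\<Sum>j\<le>m. (poly (jacobi_poly a b j) x)\<^sup>2) > 0"
      by (rule sum_pos2[of _ 0]) auto
    ultimately show False by (metis of_real_eq_0_iff less_irrefl)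
  qed
  have "q n \<noteq> 0" using deg[of n] Suc by auto
  moreover have "rsquarefree (q n)" using simple by (auto simp: rsquarefree_roots)
  ultimately have "card {z. poly (q n) z = 0} = n"
    using rsquarefree_card_degree deg by auto
  moreover have "{z. poly (q n) z = 0} = complex_of_real ` {x. poly (jacobi_poly a b n) x = 0}"
  proof (intro equalityI subsetI)
    fix z assume "z \<in> {z. poly (q n) z = 0}"
    moreover from this obtain x where "z = complex_of_real x"
      using real_root by (auto elim: Reals_cases)
    ultimately show "z \<in> complex_of_real ` {x. poly (jacobi_poly a b n) x = 0}"
      by (auto simp: q_def poly_jacobi_poly_of_real)
  qed (auto simp: q_def poly_jacobi_poly_of_real)
  ultimately show ?thesis by (simp add: card_image inj_on_def)
qed

lemma ordered_eigensystem_jacobi_mat_exists: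
  fixes b :: real
  assumes "b \<noteq> 0" "0 < n"
  shows "\<exists>lam v. ordered_eigensystem n (jacobi_mat n a b) lam v"
proof -
  define R where "R = {x. poly (jacobi_poly a b n) x = 0}"
  define lam where "lam k = sorted_list_of_set R ! k" for k
  define w where "w x = vec n (\<lambda>i. poly (jacobi_poly a b i) x)" for x
  define v where "v k = (1 / sqrt (w (lam k) \<bullet> w (lam k))) \<cdot>\<^sub>v w (lam k)" for k
  have card: "card R = n" unfolding R_def by (rule card_roots_jacobi_poly) fact
  have fin: "finite R" by (rule card_ge_0_finite) (simp add: card assms)
  have lam: "lam ` {..<n} = R"
  proof -
    have "lam ` {..<n} = set (sorted_list_of_set R)"
      using card by (auto simp: lam_def set_conv_nth)
    then show ?thesis using fin by simp
  qed
  have mono: "strict_mono_on {..<n} lam"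
    unfolding strict_mono_on_def lam_def
    using card sorted_wrt_nth_less[OF strict_sorted_list_of_set, of _ _ R] by simp
  have w: "w x \<in> carrier_vec n" "w x $ 0 = 1" for x
    using assms by (auto simp: w_def)
  have norm: "w x \<bullet> w x > 0" for x
  proof -
    have "w x \<bullet> w x = (\<Sum>i<n. (w x $ i)\<^sup>2)"
      by (simp add: w_def scalar_prod_def atLeast0LessThan power2_eq_square)
    also have "\<dots> > 0" using assms w by (intro sum_pos2[of _ 0]) auto
    finally show ?thesis .
  qed
  have ev: "eigenvector (jacobi_mat n a b) (c \<cdot>\<^sub>v w x) x" if "x \<in> R" "c \<noteq> 0" for c x
  proof -
    have carrier: "c \<cdot>\<^sub>v w x \<in> carrier_vec n" using w by simp
    have first: "(c \<cdot>\<^sub>v w x) $ 0 \<noteq> 0" using that assms by (simp add: w_def)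
    have rec: "\<forall>i<n. (c \<cdot>\<^sub>v w x) $ i = (c \<cdot>\<^sub>v w x) $ 0 * poly (jacobi_poly a b i) x"
      using assms by (simp add: w_def)
    have root: "poly (jacobi_poly a b n) x = 0" using that by (simp add: R_def)
    show ?thesis
      by (intro iffD2[OF jacobi_eigenvector_iff[OF assms carrier]] conjI first rec root)
  qed
  have spec: "spectrum (jacobi_mat n a b) = R"
  proof (intro equalityI subsetI)
    fix x assume "x \<in> spectrum (jacobi_mat n a b)"
    then obtain u where u: "eigenvector (jacobi_mat n a b) u x"
      by (auto simp: spectrum_def eigenvalue_def)
    show "x \<in> R" using jacobi_eigenvectorD(2)[OF assms u] by (simp add: R_def)
  next
    fix x assume "x \<in> R"
    then have "eigenvector (jacobi_mat n a b) (1 \<cdot>\<^sub>v w x) x" by (rule ev) simp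
    then show "x \<in> spectrum (jacobi_mat n a b)"
      unfolding spectrum_def eigenvalue_def by blast
  qed
  have eig: "eigenvector (jacobi_mat n a b) (v k) (lam k)" if "k < n" for k
  proof -
    have "lam k \<in> R" using that unfolding lam[symmetric] by blast
    then show ?thesis unfolding v_def using norm[of "lam k"] by (intro ev) auto
  qed
  have unit: "v k \<bullet> v k = 1" for k
  proof -
    have "v k \<bullet> v k = (w (lam k) \<bullet> w (lam k)) / (sqrt (w (lam k) \<bullet> w (lam k)))\<^sup>2"
      unfolding v_def by (simp add: power2_eq_square)
    then show ?thesis using norm[of "lam k"] by simp
  qed
  have "ordered_eigensystem n (jacobi_mat n a b) lam v"
    unfolding ordered_eigensystem_def spec lam unit real_sqrt_one
    by (intro conjI allI impI mono refl eig)
  then show ?thesis by blast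
qed

subsection \<open>Linear differential inequalities and invariance of the orthant\<close>

text \<open>The integrating factor \<open>exp (- c * s)\<close> turns the inequality into
  monotonicity: the product with \<open>h\<close> is nonincreasing. The constant \<open>c\<close>
  may have either sign.\<close>

lemma gronwall_nonpos:
  fixes h h' :: "real \<Rightarrow> real"
  assumes deriv: "\<And>t. t \<ge> 0 \<Longrightarrow> (h has_real_derivative h' t) (at t within {0..})"
    and le: "\<And>t. t \<ge> 0 \<Longrightarrow> h' t \<le> c * h t"
    and "h 0 \<le> 0" "t \<ge> 0"
  shows "h t \<le> 0"
proof -
  define g where "g s = h s * exp (- c * s)" for s
  have g: "(g has_real_derivative (h' s - c * h s) * exp (- c * s)) (at s within {0..})"
    if "s \<ge> 0" for s
    unfolding g_def using deriv[OF that]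
    by (auto intro!: derivative_eq_intros simp: algebra_simps)
  have "g t \<le> g 0"
  proof (rule DERIV_nonpos_imp_decreasing_open[OF \<open>t \<ge> 0\<close>])
    fix s assume s: "0 < s" "s < t"
    \<comment> \<open>At an interior point the one-sided derivative is two-sided, since the
      half-line without 0 is an open neighbourhood.\<close>
    have "(g has_real_derivative (h' s - c * h s) * exp (- c * s)) (at s within {0<..})"
      by (rule has_field_derivative_subset[OF g]) (use s in auto)
    then have "(g has_real_derivative (h' s - c * h s) * exp (- c * s)) (at s)"
      using s by (simp add: at_within_open[of s "{0<..}"])
    moreover have "(h' s - c * h s) * exp (- c * s) \<le> 0"
      using le[of s] s by (intro mult_nonpos_nonneg) auto
    ultimately show "\<exists>y. (g has_real_derivative y) (at s) \<and> y \<le> 0"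
      by blast
  next
    show "continuous_on {0..t} g"
      by (rule continuous_on_subset[of "{0..}"])
        (auto intro!: DERIV_continuous_on g)
  qed
  then have "h t * exp (- c * t) \<le> 0"
    using \<open>h 0 \<le> 0\<close> by (simp add: g_def)
  then show ?thesis
    by (simp add: mult_le_0_iff not_le[symmetric])
qed

text \<open>Squaring removes the kink of \<open>min u 0\<close>, which yields a differentiable
  measure of negativity.\<close>

lemma DERIV_min_zero_square:
  fixes u :: real
  shows "((\<lambda>u. (min u 0)\<^sup>2) has_real_derivative 2 * min u 0) (at u)"
proof -
  consider "u < 0" | "u = 0" | "u > 0" by linarith
  then show ?thesis
  proof cases
    case 1
    have "\<forall>\<^sub>F x in nhds u. (min x 0)\<^sup>2 = x\<^sup>2"
      using eventually_nhds_in_open[of "{..<0}" u] 1 by (auto elim: eventually_mono)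
    moreover have "((\<lambda>x. x\<^sup>2) has_real_derivative 2 * min u 0) (at u)"
      using 1 by (auto intro!: derivative_eq_intros)
    ultimately show ?thesis by (subst DERIV_cong_ev) auto
  next
    case 3
    have "\<forall>\<^sub>F x in nhds u. (min x 0)\<^sup>2 = 0"
      using eventually_nhds_in_open[of "{0<..}" u] 3 by (auto elim: eventually_mono)
    moreover have "((\<lambda>x. 0) has_real_derivative 2 * min u 0) (at u)"
      using 3 by (auto intro!: derivative_eq_intros)
    ultimately show ?thesis by (subst DERIV_cong_ev) auto
  next
    case 2
    have "((\<lambda>h::real. (min h 0)\<^sup>2 / h) \<longlongrightarrow> 0) (at 0)"
    proof (rule tendsto_rabs_zero_cancel, rule tendsto_sandwich[of "\<lambda>_. 0" _ _ "\<lambda>h. \<bar>h\<bar>"])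
      show "((\<lambda>h::real. \<bar>h\<bar>) \<longlongrightarrow> 0) (at 0)"
        by (intro tendsto_rabs_zero tendsto_ident_at)
    qed (auto simp: min_def power2_eq_square intro!: always_eventually)
    then show ?thesis using 2 by (simp add: DERIV_def)
  qed
qed

text \<open>Apply Gronwall's inequality to the squared distance of \<open>x s\<close> to the orthant.\<close>

lemma metzler_nonneg:
  fixes x :: "real \<Rightarrow> nat \<Rightarrow> real"
  assumes deriv: "\<And>i t. i < n \<Longrightarrow> t \<ge> 0 \<Longrightarrow>
      ((\<lambda>s. x s i) has_real_derivative (\<Sum>j<n. A i j * x t j) + b t i) (at t within {0..})"
    and off: "\<And>i j. i < n \<Longrightarrow> j < n \<Longrightarrow> i \<noteq> j \<Longrightarrow> A i j \<ge> 0"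
    and b: "\<And>i t. i < n \<Longrightarrow> t \<ge> 0 \<Longrightarrow> b t i \<ge> 0"
    and init: "\<And>i. i < n \<Longrightarrow> x 0 i \<ge> 0"
    and "i < n" "t \<ge> 0"
  shows "x t i \<ge> 0"
proof -
  define m where "m s i = min (x s i) 0" for s i
  define D where "D s = (\<Sum>i<n. (m s i)\<^sup>2)" for s
  define D' where "D' s = (\<Sum>i<n. 2 * m s i * ((\<Sum>j<n. A i j * x s j) + b s i))" for s
  \<comment> \<open>A crude constant: each product of entries with components is bounded by the
    absolute value of the entry times \<open>D s\<close>, and differentiating the square gives the
    factor 2.\<close>
  define C where "C = 2 * (\<Sum>i<n. \<Sum>j<n. \<bar>A i j\<bar>)"
  have sq_le: "(m s i)\<^sup>2 \<le> D s" if "i < n" for s i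
    unfolding D_def using that by (intro member_le_sum) auto
  have "D t \<le> 0"
  proof (rule gronwall_nonpos[of D D' C])
    fix s :: real assume s: "s \<ge> 0"
    have "((\<lambda>s. (m s i)\<^sup>2) has_real_derivative 2 * m s i * ((\<Sum>j<n. A i j * x s j) + b s i))
        (at s within {0..})" if "i < n" for i
      unfolding m_def by (rule DERIV_chain2[OF DERIV_min_zero_square deriv[OF that s]])
    then show "(D has_real_derivative D' s) (at s within {0..})"
      unfolding D_def D'_def by (intro DERIV_sum) auto
    have D: "D s \<ge> 0" unfolding D_def by (intro sum_nonneg) auto
    have entry: "m s i * (A i j * x s j) \<le> \<bar>A i j\<bar> * D s" if ij: "i < n" "j < n" for i j
    proof (cases "i = j")
      case True
      \<comment> \<open>A diagonal term is an exact square, so it is bounded whatever the sign of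
        \<open>A i i\<close>.\<close>
      have "m s i * x s i = (m s i)\<^sup>2" by (auto simp: m_def min_def power2_eq_square)
      then have "m s i * (A i j * x s j) = A i j * (m s i)\<^sup>2"
        using True by (simp add: mult.left_commute)
      also have "\<dots> \<le> \<bar>A i j\<bar> * D s"
        using sq_le[OF ij(1), of s] by (intro mult_mono) auto
      finally show ?thesis .
    next
      case False
      then have A: "A i j \<ge> 0" using off ij by simp
      have "m s i * m s j \<le> D s"
        using sum_squares_bound[of "m s i" "m s j"] sq_le[OF ij(1), of s] sq_le[OF ij(2), of s]
        by linarith
      \<comment> \<open>Replacing \<open>x s j\<close> by the smaller \<open>m s j\<close> increases
        the product because \<open>m s i\<close> is nonpositive. Nonnegativity of the off-diagonal
        entry preserves this bound.\<close>
      moreover have "m s i * x s j \<le> m s i * m s j"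
        by (intro mult_left_mono_neg) (auto simp: m_def)
      ultimately have "A i j * (m s i * x s j) \<le> A i j * D s"
        using A by (intro mult_left_mono) auto
      then show ?thesis using A by (simp add: mult.left_commute)
    qed
    have "2 * m s i * ((\<Sum>j<n. A i j * x s j) + b s i) \<le> 2 * (\<Sum>j<n. \<bar>A i j\<bar> * D s)"
      if "i < n" for i
    proof -
      have "m s i * b s i \<le> 0"
        using b[OF that s] by (intro mult_nonpos_nonneg) (auto simp: m_def)
      moreover have "(\<Sum>j<n. m s i * (A i j * x s j)) \<le> (\<Sum>j<n. \<bar>A i j\<bar> * D s)"
        using entry that by (intro sum_mono) auto
      moreover have "2 * m s i * ((\<Sum>j<n. A i j * x s j) + b s i) =
          2 * (\<Sum>j<n. m s i * (A i j * x s j)) + 2 * (m s i * b s i)"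
        by (simp add: distrib_left sum_distrib_left mult.assoc)
      ultimately show ?thesis by linarith
    qed
    then have "D' s \<le> (\<Sum>i<n. 2 * (\<Sum>j<n. \<bar>A i j\<bar> * D s))"
      unfolding D'_def by (intro sum_mono) auto
    also have "\<dots> = C * D s"
      by (simp add: C_def sum_distrib_left sum_distrib_right mult.assoc)
    finally show "D' s \<le> C * D s" .
  next
    show "D 0 \<le> 0" using init by (simp add: D_def m_def)
  qed fact
  then have "(m t i)\<^sup>2 \<le> 0" using sq_le[OF \<open>i < n\<close>, of t] by linarith
  then show ?thesis by (simp add: m_def min_def split: if_splits)
qed

lemma nonneg_cone_iff: "x \<in> nonneg_cone n \<longleftrightarrow> x \<in> carrier_vec n \<and> (\<forall>i<n. 0 \<le> x $ i)"
  unfolding nonneg_cone_def mem_Collect_eq less_eq_vec_def carrier_vec_def index_zero_vec(2)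
  by (cases "dim_vec x = n") simp_all

lemma nonpos_cone_iff: "x \<in> nonpos_cone n \<longleftrightarrow> x \<in> carrier_vec n \<and> (\<forall>i<n. x $ i \<le> 0)"
  unfolding nonpos_cone_def mem_Collect_eq less_eq_vec_def carrier_vec_def index_zero_vec(2)
  by (cases "dim_vec x = n") simp_all

text \<open>The vector form is applied twice: to \<open>x\<close> with the error as source, and to
  \<open>- e\<close> with zero source.\<close>

lemma metzler_system_nonneg:
  assumes deriv: "vec_has_derivative_on_halfline n x (\<lambda>t. B *\<^sub>v x t + g t)"
    and B: "B \<in> carrier_mat n n"
    and off: "\<And>i j. i < n \<Longrightarrow> j < n \<Longrightarrow> i \<noteq> j \<Longrightarrow> B $$ (i, j) \<ge> 0"
    and g: "\<And>t. t \<ge> 0 \<Longrightarrow> g t \<in> nonneg_cone n"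
    and "x 0 \<in> nonneg_cone n" "t \<ge> 0"
  shows "x t \<in> nonneg_cone n"
proof -
  have xc: "x s \<in> carrier_vec n" if "s \<ge> 0" for s
    using deriv that by (simp add: vec_has_derivative_on_halfline_def)
  have gc: "dim_vec (g s) = n" if "s \<ge> 0" for s
    using g[OF that] by (simp add: nonneg_cone_iff)
  have "x t $ i \<ge> 0" if "i < n" for i
  proof (rule metzler_nonneg[where x = "\<lambda>s i. x s $ i" and n = n and A = "\<lambda>i j. B $$ (i, j)"
        and b = "\<lambda>s i. g s $ i"])
    fix i s assume si: "i < n" "(0::real) \<le> s"
    have "(B *\<^sub>v x s + g s) $ i = (\<Sum>j<n. B $$ (i, j) * x s $ j) + g s $ i"
      using si B xc[OF si(2)] gc[OF si(2)] by (simp add: scalar_prod_def atLeast0LessThan)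
    then show "((\<lambda>s. x s $ i) has_real_derivative (\<Sum>j<n. B $$ (i, j) * x s $ j) + g s $ i)
        (at s within {0..})"
      using deriv si unfolding vec_has_derivative_on_halfline_def by metis
  next
    show "0 \<le> g s $ i" if "i < n" "s \<ge> 0" for i s
      using g[OF that(2)] that by (simp add: nonneg_cone_iff)
  next
    show "0 \<le> x 0 $ i" if "i < n" for i
      using assms(5) that by (simp add: nonneg_cone_iff)
  qed (use that off \<open>t \<ge> 0\<close> in auto)
  then show ?thesis
    using xc[OF \<open>t \<ge> 0\<close>] by (simp add: nonneg_cone_iff)
qed

subsection \<open>The cone of admissible initial errors\<close>

text \<open>The error matrix enters the study of the cones only through its tridiagonal form, the
  positive off-diagonal entry and the negative spectrum.\<close>

locale jacobi_eigensystem =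
  fixes n :: nat and a :: "nat \<Rightarrow> real" and b :: real
    and lam :: "nat \<Rightarrow> real" and v :: "nat \<Rightarrow> real vec"
  assumes n2: "n \<ge> 2" and b_pos: "b > 0"
    and eigensystem: "ordered_eigensystem n (jacobi_mat n a b) lam v"
    and lam_neg: "k < n \<Longrightarrow> lam k < 0"
begin

section \<open>Orthonormality and completeness of the eigenvectors\<close>

lemma lam_less: "j < k \<Longrightarrow> k < n \<Longrightarrow> lam j < lam k"
  using eigensystem strict_mono_onD[of "{..<n}" lam j k] by (simp add: ordered_eigensystem_def)

lemma eigenvector_v: "k < n \<Longrightarrow> eigenvector (jacobi_mat n a b) (v k) (lam k)"
  using eigensystem by (simp add: ordered_eigensystem_def)

lemma v_carrier [simp]: "k < n \<Longrightarrow> v k \<in> carrier_vec n"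
  using eigenvector_v by (simp add: eigenvector_def)

lemma dim_v [simp]: "k < n \<Longrightarrow> dim_vec (v k) = n"
  by (rule carrier_vecD[OF v_carrier])

lemma jacobi_mat_mult_v: "k < n \<Longrightarrow> jacobi_mat n a b *\<^sub>v v k = lam k \<cdot>\<^sub>v v k"
  using eigenvector_v by (simp add: eigenvector_def)

lemma v_0_neq_0: "k < n \<Longrightarrow> v k $ 0 \<noteq> 0"
  by (rule jacobi_eigenvectorD(1)[OF _ _ eigenvector_v]) (use n2 b_pos in simp_all)

lemma v_orthonormal:
  assumes "j < n" "k < n"
  shows "v j \<bullet> v k = (if j = k then 1 else 0)"
proof (cases "j = k")
  case True
  then show ?thesis using eigensystem assms by (simp add: ordered_eigensystem_def)
next
  case False
  have "lam j * (v j \<bullet> v k) = ((jacobi_mat n a b)\<^sup>T *\<^sub>v v j) \<bullet> v k"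
    using assms by (simp add: jacobi_mat_mult_v)
  also have "\<dots> = v j \<bullet> (jacobi_mat n a b *\<^sub>v v k)"
    by (rule transpose_vec_mult_scalar) (use assms in auto)
  also have "\<dots> = lam k * (v j \<bullet> v k)"
    using assms by (simp add: jacobi_mat_mult_v)
  finally show ?thesis
    using False lam_less[of j k] lam_less[of k j] assms by (cases "j < k") auto
qed

text \<open>A square matrix with orthonormal columns also has orthonormal rows. The row
  \<open>r = 0\<close> expands the first unit vector in the eigenvectors, which starts the sequence
  of \<open>p_vec\<close> and recovers the first component of a solution.\<close>

lemma v_complete:
  assumes "r < n" "s < n"
  shows "(\<Sum>k<n. v k $ r * v k $ s) = (if r = s then 1 else 0)"
proof -
  define V where "V = mat n n (\<lambda>(i, k). v k $ i)"
  have V: "V \<in> carrier_mat n n" by (simp add: V_def)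
  have "V\<^sup>T * V = 1\<^sub>m n"
  proof (rule eq_matI)
    fix j k assume jk: "j < dim_row (1\<^sub>m n :: real mat)" "k < dim_col (1\<^sub>m n :: real mat)"
    have "(V\<^sup>T * V) $$ (j, k) = v j \<bullet> v k"
      using jk by (auto simp: V_def scalar_prod_def)
    then show "(V\<^sup>T * V) $$ (j, k) = 1\<^sub>m n $$ (j, k)"
      using jk by (simp add: v_orthonormal)
  qed (auto simp: V_def)
  then have "V * V\<^sup>T = 1\<^sub>m n"
    using V by (intro mat_mult_left_right_inverse[of "V\<^sup>T"]) auto
  then have "(V * V\<^sup>T) $$ (r, s) = (if r = s then 1 else 0)" using assms by simp
  moreover have "(V * V\<^sup>T) $$ (r, s) = (\<Sum>k<n. v k $ r * v k $ s)"
    using assms by (auto simp: V_def scalar_prod_def atLeast0LessThan)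
  ultimately show ?thesis by simp
qed

text \<open>The factor with \<open>j = k\<close> is zero. Hence the sums defining
  \<open>p_vec\<close> may run over all \<open>k\<close>, and the product with all \<open>n\<close>
  factors annihilates every mode.\<close>

lemma newton_prod_eq_0:
  assumes "k < i" "i \<le> n"
  shows "(\<Prod>j<i. 1 - lam k / lam j) = 0"
proof (rule prod_zero)
  have "1 - lam k / lam k = 0" using assms lam_neg[of k] by simp
  then show "\<exists>j\<in>{..<i}. 1 - lam k / lam j = 0" using assms by blast
qed simp

lemma sum_from_p_vec_start:
  assumes "i < n"
  shows "(\<Sum>k=i..<n. (\<Prod>j<i. 1 - lam k / lam j) * f k)
    = (\<Sum>k<n. (\<Prod>j<i. 1 - lam k / lam j) * f k)"
proof (rule sum.mono_neutral_left)
  show "\<forall>k\<in>{..<n} - {i..<n}. (\<Prod>j<i. 1 - lam k / lam j) * f k = 0"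
  proof
    fix k assume "k \<in> {..<n} - {i..<n}"
    then have "(\<Prod>j<i. 1 - lam k / lam j) = 0"
      using assms by (intro newton_prod_eq_0) auto
    then show "(\<Prod>j<i. 1 - lam k / lam j) * f k = 0" by (simp only: mult_zero_left)
  qed
qed auto

lemma p_vec_index:
  assumes "i < n" "r < n"
  shows "p_vec n lam v i $ r = (\<Sum>k<n. (\<Prod>j<i. 1 - lam k / lam j) * (v k $ 0 * v k $ r))"
  using assms by (simp add: p_vec_def mult.assoc sum_from_p_vec_start)

lemma p_vec_carrier [simp]: "p_vec n lam v i \<in> carrier_vec n"
  by (simp add: p_vec_def)

lemma p_vec_scalar_prod:
  assumes "i < n" "e \<in> carrier_vec n"
  shows "p_vec n lam v i \<bullet> e = (\<Sum>k<n. (\<Prod>j<i. 1 - lam k / lam j) * (v k $ 0 * (v k \<bullet> e)))"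
proof -
  have "p_vec n lam v i \<bullet> e =
      (\<Sum>r<n. (\<Sum>k<n. (\<Prod>j<i. 1 - lam k / lam j) * (v k $ 0 * v k $ r)) * e $ r)"
    using assms by (simp add: scalar_prod_def atLeast0LessThan p_vec_index)
  also have "\<dots> = (\<Sum>k<n. \<Sum>r<n. (\<Prod>j<i. 1 - lam k / lam j) * (v k $ 0 * v k $ r) * e $ r)"
    unfolding sum_distrib_right by (rule sum.swap)
  also have "\<dots> = (\<Sum>k<n. (\<Prod>j<i. 1 - lam k / lam j) * (v k $ 0 * (v k \<bullet> e)))"
    using assms by (simp add: scalar_prod_def atLeast0LessThan sum_distrib_left mult.assoc)
  finally show ?thesis .
qed

text \<open>In coordinate-free terms, \<open>p (i + 1) = (I - J / lam i) p i\<close> for \<open>J = jacobi_mat n a b\<close>.\<close>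

lemma p_vec_Suc:
  assumes "Suc i < n" "r < n"
  shows "p_vec n lam v (Suc i) $ r = p_vec n lam v i $ r
    - (a r * p_vec n lam v i $ r + (if 0 < r then b * p_vec n lam v i $ (r - 1) else 0)
        + (if Suc r < n then b * p_vec n lam v i $ Suc r else 0)) / lam i"
proof -
  let ?c = "\<lambda>k. (\<Prod>j<i. 1 - lam k / lam j) * v k $ 0"
  let ?w = "\<lambda>k. a r * v k $ r + (if 0 < r then b * v k $ (r - 1) else 0)
        + (if Suc r < n then b * v k $ Suc r else 0)"
  have w: "lam k * v k $ r = ?w k" if "k < n" for k
    using jacobi_mat_mult_vec_index[OF v_carrier[OF that] assms(2), of a b] that assms
    by (simp add: jacobi_mat_mult_v)
  have "p_vec n lam v (Suc i) $ r = (\<Sum>k<n. ?c k * v k $ r - ?c k * (lam k * v k $ r) / lam i)"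
    using assms by (simp add: p_vec_index algebra_simps)
  also have "\<dots> = (\<Sum>k<n. ?c k * v k $ r - ?c k * ?w k / lam i)"
    using w by (intro sum.cong) auto
  also have "\<dots> = (\<Sum>k<n. ?c k * v k $ r) - (\<Sum>k<n. ?c k * ?w k) / lam i"
    by (simp add: sum_subtractf sum_divide_distrib)
  also have "(\<Sum>k<n. ?c k * ?w k) =
      a r * (\<Sum>k<n. ?c k * v k $ r)
        + (if 0 < r then b * (\<Sum>k<n. ?c k * v k $ (r - 1)) else 0)
        + (if Suc r < n then b * (\<Sum>k<n. ?c k * v k $ Suc r) else 0)"
    by (simp add: distrib_left sum.distrib sum_distrib_left mult.left_commute)
  finally show ?thesis
    using assms by (simp add: p_vec_index mult.assoc less_imp_diff_less)
qed

lemma p_vec_0: "r < n \<Longrightarrow> p_vec n lam v 0 $ r = (if r = 0 then 1 else 0)"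
  using n2 by (simp add: p_vec_index v_complete)

text \<open>Multiplication by a tridiagonal matrix extends the support by one index. The new last
  entry is the old one times \<open>- b / lam i\<close>, which is positive.\<close>

lemma p_vec_triangular:
  assumes "i < n"
  shows "(\<forall>r. i < r \<longrightarrow> r < n \<longrightarrow> p_vec n lam v i $ r = 0) \<and> p_vec n lam v i $ i > 0"
  using assms
proof (induction i)
  case 0
  then show ?case by (simp add: p_vec_0)
next
  case (Suc i)
  then have IH: "\<And>r. i < r \<Longrightarrow> r < n \<Longrightarrow> p_vec n lam v i $ r = 0" "p_vec n lam v i $ i > 0"
    by auto
  have "p_vec n lam v (Suc i) $ Suc i = - (b * p_vec n lam v i $ i) / lam i"
    using Suc.prems IH(1) by (simp add: p_vec_Suc)
  also have "\<dots> > 0"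
    using IH(2) b_pos lam_neg[of i] Suc.prems by (simp add: divide_pos_neg)
  finally show ?case
    using Suc.prems IH(1) by (auto simp: p_vec_Suc)
qed

section \<open>Invertibility of \<open>P_mat\<close> and the inclusion of the cones\<close>

lemma P_mat_carrier [simp]: "P_mat n lam v \<in> carrier_mat n n"
  unfolding P_mat_def using mat_of_cols_carrier(1)[of n "map (p_vec n lam v) [0..<n]"] by simp

lemma P_mat_dim [simp]: "dim_row (P_mat n lam v) = n" "dim_col (P_mat n lam v) = n"
  using P_mat_carrier by blast+

lemma col_P_mat: "i < n \<Longrightarrow> col (P_mat n lam v) i = p_vec n lam v i"
  unfolding P_mat_def by (subst col_mat_of_cols) auto

lemma P_mat_transpose_mult_index:
  assumes "i < n" "e \<in> carrier_vec n"
  shows "((P_mat n lam v)\<^sup>T *\<^sub>v e) $ i = p_vec n lam v i \<bullet> e"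
  using assms by (simp add: col_P_mat)

lemma det_P_mat: "det (P_mat n lam v) \<noteq> 0"
proof -
  have entry: "P_mat n lam v $$ (i, j) = p_vec n lam v j $ i" if "i < n" "j < n" for i j
    using that by (simp add: P_mat_def mat_of_cols_def)
  have "upper_triangular (P_mat n lam v)"
    using p_vec_triangular by (auto simp: upper_triangular_def entry)
  moreover have "0 \<notin> set (diag_mat (P_mat n lam v))"
    using p_vec_triangular by (force simp: diag_mat_def entry)
  ultimately show ?thesis
    using upper_triangular_imp_det_eq_0_iff P_mat_carrier by blast
qed

lemma P_mat_transpose_inverse:
  obtains Q where "Q \<in> carrier_mat n n" "(P_mat n lam v)\<^sup>T * Q = 1\<^sub>m n" "Q * (P_mat n lam v)\<^sup>T = 1\<^sub>m n"
proof -
  have "det (P_mat n lam v)\<^sup>T \<noteq> 0" using det_P_mat by (simp add: det_transpose[OF P_mat_carrier])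
  then have "(P_mat n lam v)\<^sup>T \<in> Units (ring_mat TYPE(real) n ())"
    by (intro det_non_zero_imp_unit) auto
  then show ?thesis using that by (auto simp: Units_def ring_mat_def)
qed

lemma F_set_iff: "e \<in> F_set n lam v \<longleftrightarrow> e \<in> carrier_vec n \<and> (\<forall>i<n. p_vec n lam v i \<bullet> e \<le> 0)"
proof -
  have "(- (P_mat n lam v)\<^sup>T *\<^sub>v e) $ i = - (p_vec n lam v i \<bullet> e)"
    if "i < n" "e \<in> carrier_vec n" for i
    using that P_mat_carrier by (simp add: col_P_mat)
  moreover have "- (P_mat n lam v)\<^sup>T *\<^sub>v e \<in> carrier_vec n" if "e \<in> carrier_vec n"
    by (rule mult_mat_vec_carrier[OF _ that]) simp
  ultimately show ?thesis
    by (auto simp: F_set_def nonneg_cone_iff)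
qed

lemma F_set_subset_E_set: "F_set n lam v \<subseteq> E_set n lam v"
proof
  fix e assume e: "e \<in> F_set n lam v"
  then have ec: "e \<in> carrier_vec n" by (simp add: F_set_iff)
  \<comment> \<open>The value \<open>h i 0\<close> is the scalar product of
    \<open>p_vec n lam v i\<close> with \<open>e\<close>, and \<open>h 0\<close> is the function in
    \<open>E_set\<close>.\<close>
  define h where "h i t =
    (\<Sum>k<n. (\<Prod>j<i. 1 - lam k / lam j) * (v k $ 0 * (v k \<bullet> e)) * exp (lam k * t))" for i t
  have h0: "h i 0 \<le> 0" if "i < n" for i
    using e that ec by (simp add: F_set_iff h_def p_vec_scalar_prod)
  have deriv: "(h i has_real_derivative lam i * (h i t - h (Suc i) t)) (at t within {0..})"
    if "i < n" for i t
  proof -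
    let ?c = "\<lambda>k. (\<Prod>j<i. 1 - lam k / lam j) * (v k $ 0 * (v k \<bullet> e))"
    have "((\<lambda>t. exp (lam k * t)) has_real_derivative lam k * exp (lam k * t)) (at t within {0..})" for k
      by (auto intro!: derivative_eq_intros)
    then have "(h i has_real_derivative (\<Sum>k<n. ?c k * (lam k * exp (lam k * t)))) (at t within {0..})"
      unfolding h_def by (intro DERIV_sum DERIV_cmult)
    \<comment> \<open>Modewise, passing from \<open>h i\<close> to \<open>h (Suc i)\<close>
      multiplies by \<open>1 - lam k / lam i\<close>, so the difference carries the factor
      \<open>lam k / lam i\<close>.\<close>
    moreover have "lam i * (h i t - h (Suc i) t) = (\<Sum>k<n. ?c k * (lam k * exp (lam k * t)))"
      unfolding h_def sum_subtractf[symmetric] sum_distrib_left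
      using lam_neg[OF that] by (intro sum.cong) (auto simp: field_simps)
    ultimately show ?thesis by simp
  qed
  \<comment> \<open>The induction descends from \<open>n\<close>; the time stays arbitrary because
    each step uses the sign of \<open>h (Suc i)\<close> on the whole half-line.\<close>
  have "h i t \<le> 0" if "i \<le> n" "t \<ge> 0" for i t
    using that
  proof (induction i arbitrary: t rule: inc_induct)
    case base
    have "h n t = (\<Sum>k<n. 0 * (v k $ 0 * (v k \<bullet> e)) * exp (lam k * t))"
      unfolding h_def
    proof (rule sum.cong[OF refl])
      fix k assume "k \<in> {..<n}"
      then have "(\<Prod>j<n. 1 - lam k / lam j) = 0" by (intro newton_prod_eq_0) auto
      then show "(\<Prod>j<n. 1 - lam k / lam j) * (v k $ 0 * (v k \<bullet> e)) * exp (lam k * t) =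
          0 * (v k $ 0 * (v k \<bullet> e)) * exp (lam k * t)" by (simp only:)
    qed
    then show ?case by simp
  next
    case (step i)
    show ?case
    proof (rule gronwall_nonpos[OF deriv])
      show "lam i * (h i s - h (Suc i) s) \<le> lam i * h i s" if "s \<ge> 0" for s
        using step.IH[OF that] lam_neg[of i] step.hyps
        by (simp add: right_diff_distrib zero_le_mult_iff)
    qed (use step h0 in auto)
  qed
  moreover have "vec n (\<lambda>r. \<Sum>i<n. exp (lam i * t) * v i $ 0 * v i $ r) \<bullet> e = h 0 t" for t
  proof -
    have "vec n (\<lambda>r. \<Sum>i<n. exp (lam i * t) * v i $ 0 * v i $ r) \<bullet> e =
        (\<Sum>i<n. \<Sum>r<n. exp (lam i * t) * v i $ 0 * v i $ r * e $ r)"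
      using ec by (simp add: scalar_prod_def atLeast0LessThan sum_distrib_right) (rule sum.swap)
    also have "\<dots> = h 0 t"
      using ec by (simp add: h_def scalar_prod_def atLeast0LessThan sum_distrib_left sum_distrib_right
          algebra_simps)
    finally show ?thesis .
  qed
  ultimately show "e \<in> E_set n lam v"
    using ec by (simp add: E_set_def)
qed

text \<open>The map sending \<open>e\<close> to minus the transpose of \<open>P_mat\<close> applied
  to \<open>e\<close> has the inverse \<open>x\<close> to \<open>- (Q *\<^sub>v x)\<close>. Each
  inclusion uses one of the two inverse equations.\<close>

lemma F_set_eq_image:
  assumes Q: "Q \<in> carrier_mat n n" "(P_mat n lam v)\<^sup>T * Q = 1\<^sub>m n" "Q * (P_mat n lam v)\<^sup>T = 1\<^sub>m n"
  shows "F_set n lam v = {- (Q *\<^sub>v x) | x. x \<in> nonneg_cone n}"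
proof -
  let ?T = "(P_mat n lam v)\<^sup>T"
  have T: "?T \<in> carrier_mat n n" by simp
  have uminus: "B *\<^sub>v (- w) = - (B *\<^sub>v w)"
    if "B \<in> carrier_mat n n" "w \<in> carrier_vec n" for B :: "real mat" and w
    using that by (intro eq_vecI) auto
  have cancel: "B *\<^sub>v (- (C *\<^sub>v w)) = - w"
    if "B \<in> carrier_mat n n" "C \<in> carrier_mat n n" "B * C = 1\<^sub>m n" "w \<in> carrier_vec n"
    for B C :: "real mat" and w
  proof -
    have "B *\<^sub>v (C *\<^sub>v w) = (B * C) *\<^sub>v w"
      by (rule assoc_mult_mat_vec[OF that(1,2,4), symmetric])
    also have "\<dots> = w" unfolding that(3) using that(4) by (rule one_mult_mat_vec)
    finally show ?thesis using that uminus[of B "C *\<^sub>v w"] by simp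
  qed
  have T_uminus: "- ?T *\<^sub>v e = - (?T *\<^sub>v e)" if "e \<in> carrier_vec n" for e
    using that by (intro uminus_mult_mat_vec) simp
  show ?thesis
  proof (intro equalityI subsetI)
    fix e assume "e \<in> F_set n lam v"
    then have e: "e \<in> carrier_vec n" and "- ?T *\<^sub>v e \<in> nonneg_cone n"
      by (simp_all only: F_set_def mem_Collect_eq)
    then have x: "- (?T *\<^sub>v e) \<in> nonneg_cone n" by (simp only: T_uminus)
    have "e = - (Q *\<^sub>v (- (?T *\<^sub>v e)))"
      unfolding cancel[OF Q(1) T Q(3) e] by simp
    with x show "e \<in> {- (Q *\<^sub>v x) | x. x \<in> nonneg_cone n}"
      by (intro CollectI exI conjI)
  next
    fix e assume "e \<in> {- (Q *\<^sub>v x) | x. x \<in> nonneg_cone n}"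
    then obtain x where e: "e = - (Q *\<^sub>v x)" and x: "x \<in> nonneg_cone n" by blast
    have xc: "x \<in> carrier_vec n"
      using x by (simp add: nonneg_cone_iff)
    have ec: "e \<in> carrier_vec n" unfolding e using Q(1) xc by simp
    have "- ?T *\<^sub>v e = x"
      unfolding T_uminus[OF ec] unfolding e cancel[OF T Q(1,2) xc] by simp
    then show "e \<in> F_set n lam v"
      using x ec by (simp only: F_set_def mem_Collect_eq)
  qed
qed

text \<open>Take \<open>e\<close> orthogonal to all columns of \<open>P_mat\<close> but the first. As the second column is
  \<open>(\<alpha>, \<beta>, 0, \<dots>, 0)\<close> with \<open>\<alpha>, \<beta> > 0\<close>, the first two components of \<open>e\<close> have opposite signs.\<close>

lemma F_set_not_nonpos: "F_set n lam v - nonpos_cone n \<noteq> {}"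
proof -
  obtain Q where Q: "Q \<in> carrier_mat n n" "(P_mat n lam v)\<^sup>T * Q = 1\<^sub>m n"
    using P_mat_transpose_inverse by blast
  define e where "e = Q *\<^sub>v (- unit_vec n 0)"
  have e: "e \<in> carrier_vec n" using Q by (simp add: e_def)
  have "(P_mat n lam v)\<^sup>T *\<^sub>v e = - unit_vec n 0"
    using Q unfolding e_def by (subst assoc_mult_mat_vec[symmetric, of _ n n _ n]) auto
  then have p: "p_vec n lam v i \<bullet> e = (if i = 0 then - 1 else 0)" if "i < n" for i
    using P_mat_transpose_mult_index[OF that e] that by (simp split: if_splits)
  \<comment> \<open>By triangularity the first two columns vanish beyond index 1.\<close>
  have prod2: "p_vec n lam v i \<bullet> e = p_vec n lam v i $ 0 * e $ 0 + p_vec n lam v i $ 1 * e $ 1"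
    if "i < 2" for i
  proof -
    have "p_vec n lam v i \<bullet> e = (\<Sum>r<n. p_vec n lam v i $ r * e $ r)"
      using e by (simp add: scalar_prod_def atLeast0LessThan)
    also have "\<dots> = (\<Sum>r<2. p_vec n lam v i $ r * e $ r)"
      using n2 that p_vec_triangular[of i] by (intro sum.mono_neutral_right) auto
    finally show ?thesis by (simp add: numeral_2_eq_2)
  qed
  have "e $ 0 = - 1"
    using prod2[of 0] p[of 0] n2 by (simp add: p_vec_0)
  then have "p_vec n lam v 1 $ 1 * e $ 1 = p_vec n lam v 1 $ 0"
    using prod2[of 1] p[of 1] n2 by simp
  moreover have "p_vec n lam v 1 $ 0 > 0"
  proof -
    \<comment> \<open>As \<open>lam 0\<close> is the most negative eigenvalue, no summand is
      negative; the one for \<open>k = 1\<close> is positive because eigenvectors of a Jacobi matrix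
      have nonzero first component.\<close>
    have "p_vec n lam v 1 $ 0 = (\<Sum>k<n. (1 - lam k / lam 0) * (v k $ 0)\<^sup>2)"
      using n2 by (simp add: p_vec_index power2_eq_square)
    also have "\<dots> > 0"
    proof (rule sum_pos2[of _ 1])
      have "lam k / lam 0 \<le> 1" if "k < n" for k
        using lam_neg[of 0] lam_less[of 0 k] n2 that by (cases "k = 0") (auto simp: divide_le_eq)
      then show "\<And>k. k \<in> {..<n} \<Longrightarrow> 0 \<le> (1 - lam k / lam 0) * (v k $ 0)\<^sup>2"
        by simp
      have "lam 1 / lam 0 < 1"
        using lam_neg[of 0] lam_less[of 0 1] n2 by (auto simp: divide_less_eq)
      then show "0 < (1 - lam 1 / lam 0) * (v 1 $ 0)\<^sup>2"
        using v_0_neq_0[of 1] n2 by simp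
    qed (use n2 in auto)
    finally show ?thesis .
  qed
  moreover have "p_vec n lam v 1 $ 1 > 0"
    using p_vec_triangular[of 1] n2 by simp
  ultimately have "e $ 1 > 0"
    by (metis zero_less_mult_pos)
  have "e \<notin> nonpos_cone n"
  proof
    assume "e \<in> nonpos_cone n"
    then have "e $ 1 \<le> 0" using n2 by (simp add: nonpos_cone_iff)
    with \<open>e $ 1 > 0\<close> show False by simp
  qed
  moreover have "e \<in> F_set n lam v"
    using e p by (simp add: F_set_iff)
  ultimately show ?thesis by blast
qed

text \<open>Projection onto the eigenvectors decouples the system into scalar equations. This covers
  every solution, without constructing a matrix exponential.\<close>

lemma solution_0_eq:
  assumes deriv: "vec_has_derivative_on_halfline n e (\<lambda>t. jacobi_mat n a b *\<^sub>v e t)"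
    and "t \<ge> 0"
  shows "e t $ 0 = vec n (\<lambda>r. \<Sum>i<n. exp (lam i * t) * v i $ 0 * v i $ r) \<bullet> e 0"
proof -
  have ec: "e t \<in> carrier_vec n" if "t \<ge> 0" for t
    using deriv that by (simp add: vec_has_derivative_on_halfline_def)
  define q where "q k s = (\<Sum>r<n. v k $ r * e s $ r)" for k s
  have qd: "(q k has_real_derivative lam k * q k s) (at s within {0..})" if "k < n" "s \<ge> 0" for k s
  proof -
    have "(q k has_real_derivative (\<Sum>r<n. v k $ r * (jacobi_mat n a b *\<^sub>v e s) $ r)) (at s within {0..})"
      unfolding q_def using deriv that
      by (intro DERIV_sum DERIV_cmult) (auto simp: vec_has_derivative_on_halfline_def)
    moreover have "(\<Sum>r<n. v k $ r * (jacobi_mat n a b *\<^sub>v e s) $ r) = lam k * q k s"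
    proof -
      have "(\<Sum>r<n. v k $ r * (jacobi_mat n a b *\<^sub>v e s) $ r) = v k \<bullet> (jacobi_mat n a b *\<^sub>v e s)"
        by (simp add: scalar_prod_def atLeast0LessThan)
      also have "\<dots> = ((jacobi_mat n a b)\<^sup>T *\<^sub>v v k) \<bullet> e s"
        by (rule transpose_vec_mult_scalar[symmetric]) (use that ec in auto)
      also have "\<dots> = lam k * (v k \<bullet> e s)"
        using smult_scalar_prod_distrib[of "v k" n "e s" "lam k"] that ec
        by (simp add: jacobi_mat_mult_v)
      also have "v k \<bullet> e s = q k s"
        using ec[OF that(2)] by (simp add: scalar_prod_def atLeast0LessThan q_def)
      finally show ?thesis .
    qed
    ultimately show ?thesis by simp
  qed
  \<comment> \<open>Uniqueness for the scalar equation: the difference to the exponential starts at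
    0, and Gronwall's inequality applies to it and to its negative.\<close>
  have q: "q k t = q k 0 * exp (lam k * t)" if k: "k < n" for k
  proof -
    have d: "((\<lambda>s. q k s - q k 0 * exp (lam k * s)) has_real_derivative
        lam k * (q k s - q k 0 * exp (lam k * s))) (at s within {0..})" if "s \<ge> 0" for s
    proof -
      have "((\<lambda>s. exp (lam k * s)) has_real_derivative lam k * exp (lam k * s)) (at s within {0..})"
        by (auto intro!: derivative_eq_intros)
      from DERIV_diff[OF qd[OF k that] DERIV_cmult[OF this, of "q k 0"]] show ?thesis
        by (simp add: right_diff_distrib mult.left_commute)
    qed
    have "q k t - q k 0 * exp (lam k * t) \<le> 0"
      by (rule gronwall_nonpos[OF d]) (use \<open>t \<ge> 0\<close> in auto)
    moreover have "- (q k t - q k 0 * exp (lam k * t)) \<le> 0"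
      by (rule gronwall_nonpos[OF DERIV_minus[OF d], where c = "lam k"])
        (use \<open>t \<ge> 0\<close> in \<open>auto simp: algebra_simps\<close>)
    ultimately show ?thesis by simp
  qed
  have "e t $ 0 = (\<Sum>r<n. (if 0 = r then 1 else 0) * e t $ r)"
    using n2 by (simp add: if_distrib[of "\<lambda>x. x * _"] sum.delta' cong: if_cong)
  also have "\<dots> = (\<Sum>r<n. (\<Sum>k<n. v k $ 0 * v k $ r) * e t $ r)"
    using n2 by (intro sum.cong) (auto simp: v_complete)
  also have "\<dots> = (\<Sum>k<n. v k $ 0 * q k t)"
    unfolding q_def sum_distrib_left sum_distrib_right
    by (subst sum.swap) (simp add: mult.assoc)
  also have "\<dots> = (\<Sum>k<n. v k $ 0 * (q k 0 * exp (lam k * t)))"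
    using q by simp
  also have "\<dots> = vec n (\<lambda>r. \<Sum>i<n. exp (lam i * t) * v i $ 0 * v i $ r) \<bullet> e 0"
    using ec[of 0] by (simp add: scalar_prod_def atLeast0LessThan q_def sum_distrib_left sum_distrib_right)
      (subst sum.swap, simp add: mult_ac)
  finally show ?thesis .
qed

end

subsection \<open>The error matrix\<close>

lemma S_mat_conj_index:
  assumes "B \<in> carrier_mat n n" "i < n" "j < n"
  shows "(S_mat n * B * S_mat n) $$ (i, j) = B $$ (n - 1 - i, n - 1 - j)"
proof -
  have S: "S_mat n \<in> carrier_mat n n" by (simp add: S_mat_def)
  have SB: "(S_mat n * B) $$ (i, k) = B $$ (n - 1 - i, k)" if "k < n" for k
  proof -
    have "(S_mat n * B) $$ (i, k) = (\<Sum>l<n. (if i + l = n - 1 then 1 else 0) * B $$ (l, k))"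
      using assms that by (simp add: S_mat_def scalar_prod_def atLeast0LessThan)
    also have "\<dots> = (\<Sum>l<n. (if l = n - 1 - i then B $$ (l, k) else 0))"
      using assms by (intro sum.cong) auto
    finally show ?thesis using assms by simp
  qed
  have "(S_mat n * B * S_mat n) $$ (i, j) = (\<Sum>l<n. (S_mat n * B) $$ (i, l) * S_mat n $$ (l, j))"
    using assms S by (subst index_mult_mat(1)) (auto simp: scalar_prod_def atLeast0LessThan)
  also have "\<dots> = (\<Sum>l<n. (if l = n - 1 - j then B $$ (n - 1 - i, l) else 0))"
    using assms SB by (intro sum.cong) (auto simp: S_mat_def)
  finally show ?thesis using assms by simp
qed

lemma A_eta_carrier [simp]: "A_eta n Da L \<eta> \<in> carrier_mat n n"
  by (simp add: A_eta_def A_mat_def e1e1T_def)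

lemma A_eta_index:
  assumes "i < n" "j < n"
  shows "A_eta n Da L \<eta> $$ (i, j) =
    (if i = j then (if i = 0 \<or> i = n - 1 then - coef2 n Da L else - 2 * coef2 n Da L)
        + (if i = 0 then \<eta> * coef1 n Da L else 0)
     else if i = Suc j \<or> j = Suc i then coef2 n Da L else 0)"
  using assms by (auto simp: A_eta_def A_mat_def e1e1T_def)

text \<open>Conjugation by \<open>S_mat\<close> reverses both indices, so the \<gamma> term sits in
  the last diagonal entry, opposite to the component that drives \<open>x\<close>.\<close>

definition error_diag :: "nat \<Rightarrow> real \<Rightarrow> real \<Rightarrow> real \<Rightarrow> nat \<Rightarrow> real" where
  "error_diag n Da L \<gamma> i =
    (if i = n - 1 then \<gamma> * coef1 n Da L - coef2 n Da L
     else if i = 0 then - coef2 n Da L else - 2 * coef2 n Da L)"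

lemma error_mat_eq_jacobi_mat:
  assumes "n \<ge> 2"
  shows "error_mat n Da L \<gamma> = jacobi_mat n (error_diag n Da L \<gamma>) (coef2 n Da L)"
proof (rule eq_matI)
  fix i j assume "i < dim_row (jacobi_mat n (error_diag n Da L \<gamma>) (coef2 n Da L))"
    "j < dim_col (jacobi_mat n (error_diag n Da L \<gamma>) (coef2 n Da L))"
  then have ij: "i < n" "j < n" by auto
  then have "error_mat n Da L \<gamma> $$ (i, j) = A_eta n Da L \<gamma> $$ (n - 1 - i, n - 1 - j)"
    unfolding error_mat_def by (intro S_mat_conj_index) auto
  moreover have "n - 1 - i = n - 1 - j \<longleftrightarrow> i = j" "n - 1 - i = 0 \<longleftrightarrow> i = n - 1"
    "n - 1 - i = n - 1 \<longleftrightarrow> i = 0"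
    "n - 1 - i = Suc (n - 1 - j) \<or> n - 1 - j = Suc (n - 1 - i) \<longleftrightarrow> i = Suc j \<or> j = Suc i"
    using ij by auto
  ultimately show "error_mat n Da L \<gamma> $$ (i, j) =
      jacobi_mat n (error_diag n Da L \<gamma>) (coef2 n Da L) $$ (i, j)"
    using ij assms by (auto simp: A_eta_index jacobi_mat_def error_diag_def)
qed (simp_all add: error_mat_def S_mat_def)

text \<open>For \<open>x \<ge> 0\<close> the recurrence makes the components of a would-be eigenvector monotone, which
  contradicts the last row since \<open>\<gamma> < 0\<close>.\<close>

lemma poly_error_diag_neq_0:
  assumes "n \<ge> 2" "coef2 n Da L > 0" "\<gamma> * coef1 n Da L < 0" "x \<ge> 0"
  shows "poly (jacobi_poly (error_diag n Da L \<gamma>) (coef2 n Da L) n) x \<noteq> 0"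
proof -
  define b where "b = coef2 n Da L"
  define a where "a = error_diag n Da L \<gamma>"
  define c where "c = \<gamma> * coef1 n Da L"
  define f where "f i = poly (jacobi_poly a b i) x" for i
  have b: "b > 0" and c: "c < 0" using assms by (auto simp: b_def c_def)
  have a: "a 0 = - b" "a (n - 1) = c - b" "\<And>i. 0 < i \<Longrightarrow> i < n - 1 \<Longrightarrow> a i = - 2 * b"
    using assms by (auto simp: a_def error_diag_def b_def c_def)
  have f0: "f 0 = 1" and f1: "b * f 1 = (x - a 0)"
    using b by (auto simp: f_def field_simps)
  have rec: "b * f (Suc (Suc i)) = (x - a (Suc i)) * f (Suc i) - b * f i" for i
    using b by (simp add: f_def field_simps)
  have mono: "1 \<le> f i \<and> f i \<le> f (Suc i)" if "Suc i < n" for i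
    using that
  proof (induction i)
    case 0
    have "b * 1 \<le> b * f 1" using f1 a assms by simp
    then show ?case using b f0 by simp
  next
    case (Suc i)
    then have IH: "1 \<le> f i" "f i \<le> f (Suc i)" by auto
    have "b * f (Suc (Suc i)) - b * f (Suc i) = x * f (Suc i) + b * (f (Suc i) - f i)"
      using rec[of i] a(3)[of "Suc i"] Suc.prems by (simp add: algebra_simps)
    also have "\<dots> \<ge> 0" using IH b assms by simp
    finally show ?case using IH b by simp
  qed
  obtain m where m: "n = Suc (Suc m)" using assms by (metis add_2_eq_Suc le_Suc_ex)
  \<comment> \<open>The last diagonal entry is \<open>c - b\<close>, so two nonnegative terms are
    joined by \<open>- c * f (Suc m)\<close>, which is positive.\<close>
  have "b * f n = x * f (Suc m) + b * (f (Suc m) - f m) + - c * f (Suc m)"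
    using rec[of m] m a(2) by (simp only: diff_Suc_1) (simp add: algebra_simps)
  also have "\<dots> > 0"
    using mono[of m] m b c assms by (intro add_nonneg_pos add_nonneg_nonneg mult_pos_pos) auto
  finally show ?thesis using b by (auto simp: f_def a_def b_def)
qed

lemma jacobi_eigensystem_error_mat:
  assumes "n \<ge> 2" "Da > 0" "L > 0" "\<gamma> < 0"
    and ev: "ordered_eigensystem n (error_mat n Da L \<gamma>) lam v"
  shows "jacobi_eigensystem n (error_diag n Da L \<gamma>) (coef2 n Da L) lam v"
proof
  have g: "grid_step n L > 0" using assms by (simp add: grid_step_def)
  show b: "coef2 n Da L > 0" using assms g by (simp add: coef2_def)
  have c: "\<gamma> * coef1 n Da L < 0" using assms g unfolding coef1_def by (intro mult_neg_pos divide_pos_pos)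
  show sys: "ordered_eigensystem n (jacobi_mat n (error_diag n Da L \<gamma>) (coef2 n Da L)) lam v"
    using ev assms by (simp add: error_mat_eq_jacobi_mat)
  fix k assume "k < n"
  then have "eigenvector (jacobi_mat n (error_diag n Da L \<gamma>) (coef2 n Da L)) (v k) (lam k)"
    using sys by (simp add: ordered_eigensystem_def)
  then have "poly (jacobi_poly (error_diag n Da L \<gamma>) (coef2 n Da L) n) (lam k) = 0"
    by (rule jacobi_eigenvectorD(2)[rotated 2]) (use b assms in auto)
  then show "lam k < 0"
    using poly_error_diag_neq_0[OF assms(1) b c] by (meson not_le)
qed fact

text \<open>The two kinds of initial error need different arguments: on \<open>F_set\<close> the
  explicit formula gives the sign of the first component, on the nonpositive cone all components of
  \<open>- e\<close> stay nonnegative.\<close>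

lemma error_first_component_nonpos:
  assumes "n \<ge> 2" "Da > 0" "L > 0" "\<gamma> < 0"
    and ev: "ordered_eigensystem n (error_mat n Da L \<gamma>) lam v"
    and deriv: "vec_has_derivative_on_halfline n e (\<lambda>t. error_mat n Da L \<gamma> *\<^sub>v e t)"
    and e0: "e 0 \<in> F_set n lam v \<union> nonpos_cone n" and "t \<ge> 0"
  shows "e t $ 0 \<le> 0"
proof -
  interpret jacobi_eigensystem n "error_diag n Da L \<gamma>" "coef2 n Da L" lam v
    using assms by (intro jacobi_eigensystem_error_mat)
  note M = error_mat_eq_jacobi_mat[OF \<open>n \<ge> 2\<close>]
  from e0 show ?thesis
  proof
    assume "e 0 \<in> F_set n lam v"
    then have "e 0 \<in> E_set n lam v" using F_set_subset_E_set by blast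
    then show ?thesis
      using solution_0_eq[OF deriv[unfolded M] \<open>t \<ge> 0\<close>] \<open>t \<ge> 0\<close> by (simp add: E_set_def)
  next
    assume e0: "e 0 \<in> nonpos_cone n"
    have ec: "e s \<in> carrier_vec n" if "s \<ge> 0" for s
      using deriv that by (simp add: vec_has_derivative_on_halfline_def)
    have "vec_has_derivative_on_halfline n (\<lambda>t. - e t)
        (\<lambda>t. error_mat n Da L \<gamma> *\<^sub>v (- e t) + 0\<^sub>v n)"
      unfolding vec_has_derivative_on_halfline_def
    proof (intro allI impI conjI)
      fix s :: real and i assume s: "0 \<le> s" "i < n"
      have "((\<lambda>s. - (e s $ i)) has_real_derivative - (error_mat n Da L \<gamma> *\<^sub>v e s) $ i)
          (at s within {0..})"
        using deriv s by (intro DERIV_minus) (simp add: vec_has_derivative_on_halfline_def)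
      moreover have "(error_mat n Da L \<gamma> *\<^sub>v (- e s) + 0\<^sub>v n) $ i = - (error_mat n Da L \<gamma> *\<^sub>v e s) $ i"
        using s ec[OF s(1)] by (simp add: M)
      ultimately have "((\<lambda>s. - (e s $ i)) has_real_derivative
          (error_mat n Da L \<gamma> *\<^sub>v (- e s) + 0\<^sub>v n) $ i) (at s within {0..})"
        by simp
      \<comment> \<open>Negation commutes with taking a component only for vectors of dimension
        \<open>n\<close>, which is known on the half-line alone; hence the transfer within
        \<open>{0..}\<close>.\<close>
      then show "((\<lambda>s. (- e s) $ i) has_real_derivative
          (error_mat n Da L \<gamma> *\<^sub>v (- e s) + 0\<^sub>v n) $ i) (at s within {0..})"
        by (rule has_field_derivative_transform_within[where d = 1])
          (use s in \<open>simp_all add: carrier_vecD[OF ec]\<close>)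
    qed (use ec in auto)
    then have "- e t \<in> nonneg_cone n"
    proof (rule metzler_system_nonneg)
      show "0 \<le> error_mat n Da L \<gamma> $$ (i, j)" if "i < n" "j < n" "i \<noteq> j" for i j
        using that b_pos by (auto simp: M jacobi_mat_def)
      show "- e 0 \<in> nonneg_cone n"
        using e0 by (auto simp: nonneg_cone_iff nonpos_cone_iff)
    qed (use \<open>t \<ge> 0\<close> in \<open>auto simp: M nonneg_cone_iff\<close>)
    then show ?thesis
      using n2 by (auto simp: nonneg_cone_iff)
  qed
qed

theorem theorem14:
  fixes n :: nat and Da L :: real
  assumes "n \<ge> 2" and "Da > 0" and "L > 0"
  shows
    "(\<forall>\<gamma><0.
        (\<exists>lam v. ordered_eigensystem n (error_mat n Da L \<gamma>) lam v) \<and>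
        (\<forall>lam v. ordered_eigensystem n (error_mat n Da L \<gamma>) lam v \<longrightarrow>
           (\<forall>j<n. lam j \<noteq> 0) \<and>
           F_set n lam v \<subseteq> E_set n lam v \<and>
           F_set n lam v - nonpos_cone n \<noteq> {} \<and>
           (\<exists>Q \<in> carrier_mat n n.
              inverts_mat (P_mat n lam v)\<^sup>T Q \<and> inverts_mat Q (P_mat n lam v)\<^sup>T \<and>
              F_set n lam v = {- (Q *\<^sub>v a) | a. a \<in> nonneg_cone n})))
     \<and>
     (\<forall>\<kappa><0. \<forall>\<gamma><0. \<kappa> \<noteq> \<gamma> \<longrightarrow>
        (\<forall>lam v. ordered_eigensystem n (error_mat n Da L \<gamma>) lam v \<longrightarrow>
           (\<forall>e0 \<in> F_set n lam v \<union> nonpos_cone n. \<forall>x0 \<in> nonneg_cone n.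
              \<forall>x e. solves_system n Da L \<kappa> \<gamma> x0 e0 x e \<longrightarrow>
                (\<forall>t\<ge>0. x t \<in> nonneg_cone n))))"
proof (intro conjI allI impI ballI)
  fix \<gamma> :: real assume "\<gamma> < 0"
  have g: "grid_step n L > 0" using assms by (simp add: grid_step_def)
  then show "\<exists>lam v. ordered_eigensystem n (error_mat n Da L \<gamma>) lam v"
    unfolding error_mat_eq_jacobi_mat[OF assms(1)] using assms
    by (intro ordered_eigensystem_jacobi_mat_exists) (auto simp: coef2_def)
  fix lam v assume "ordered_eigensystem n (error_mat n Da L \<gamma>) lam v"
  then interpret jacobi_eigensystem n "error_diag n Da L \<gamma>" "coef2 n Da L" lam v
    using assms \<open>\<gamma> < 0\<close> by (intro jacobi_eigensystem_error_mat)
  show "lam j \<noteq> 0" if "j < n" for j using lam_neg[OF that] by simp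
  show "F_set n lam v \<subseteq> E_set n lam v" by (rule F_set_subset_E_set)
  show "F_set n lam v - nonpos_cone n \<noteq> {}" by (rule F_set_not_nonpos)
  show "\<exists>Q \<in> carrier_mat n n.
      inverts_mat (P_mat n lam v)\<^sup>T Q \<and> inverts_mat Q (P_mat n lam v)\<^sup>T \<and>
      F_set n lam v = {- (Q *\<^sub>v a) | a. a \<in> nonneg_cone n}"
  proof -
    obtain Q where Q: "Q \<in> carrier_mat n n" "(P_mat n lam v)\<^sup>T * Q = 1\<^sub>m n"
        "Q * (P_mat n lam v)\<^sup>T = 1\<^sub>m n"
      by (rule P_mat_transpose_inverse)
    then show ?thesis
      using F_set_eq_image[OF Q] by (intro bexI[of _ Q]) (auto simp: inverts_mat_def)
  qed
next
  fix \<kappa> \<gamma> lam v e0 x0 x e and t :: real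
  assume "\<kappa> < 0" "\<gamma> < 0" and ev: "ordered_eigensystem n (error_mat n Da L \<gamma>) lam v"
    and e0: "e0 \<in> F_set n lam v \<union> nonpos_cone n" and x0: "x0 \<in> nonneg_cone n"
    and sol: "solves_system n Da L \<kappa> \<gamma> x0 e0 x e" and "t \<ge> 0"
  from sol have dx: "vec_has_derivative_on_halfline n x
       (\<lambda>t. A_eta n Da L \<kappa> *\<^sub>v x t + ((\<kappa> * coef1 n Da L) \<cdot>\<^sub>m e1e1T n) *\<^sub>v e t)"
    and de: "vec_has_derivative_on_halfline n e (\<lambda>t. error_mat n Da L \<gamma> *\<^sub>v e t)"
    and init: "x 0 = x0" "e 0 = e0"
    by (auto simp: solves_system_def)
  have g: "grid_step n L > 0" using assms by (simp add: grid_step_def)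
  show "x t \<in> nonneg_cone n"
  \<comment> \<open>The feedback alters only a diagonal entry, so the off-diagonal ones stay
    nonnegative. The source is nonnegative as the product of a negative gain and a nonpositive
    \<open>e s $ 0\<close>.\<close>
  proof (rule metzler_system_nonneg[OF dx])
    show "0 \<le> A_eta n Da L \<kappa> $$ (i, j)" if "i < n" "j < n" "i \<noteq> j" for i j
      using that assms g by (auto simp: A_eta_index coef2_def)
    fix s :: real assume s: "s \<ge> 0"
    have ec: "e s \<in> carrier_vec n"
      using de s by (simp add: vec_has_derivative_on_halfline_def)
    have e: "e s $ 0 \<le> 0"
      using e0 init s \<open>\<gamma> < 0\<close> by (intro error_first_component_nonpos[OF assms _ ev de]) auto
    have "(((\<kappa> * coef1 n Da L) \<cdot>\<^sub>m e1e1T n) *\<^sub>v e s) $ i =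
        (if i = 0 then \<kappa> * coef1 n Da L * e s $ 0 else 0)" if "i < n" for i
    proof -
      have "(((\<kappa> * coef1 n Da L) \<cdot>\<^sub>m e1e1T n) *\<^sub>v e s) $ i =
          (\<Sum>j<n. ((\<kappa> * coef1 n Da L) \<cdot>\<^sub>m e1e1T n) $$ (i, j) * e s $ j)"
        using that ec by (simp add: e1e1T_def scalar_prod_def atLeast0LessThan)
      also have "\<dots> =
          (\<Sum>j<n. if j = 0 then (if i = 0 then \<kappa> * coef1 n Da L * e s $ 0 else 0) else 0)"
        using that by (intro sum.cong) (auto simp: e1e1T_def)
      finally show ?thesis using assms by simp
    qed
    moreover have "\<kappa> * coef1 n Da L * e s $ 0 \<ge> 0"
      using \<open>\<kappa> < 0\<close> g assms e unfolding coef1_def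
      by (intro mult_nonpos_nonpos[of "\<kappa> * _"] mult_nonpos_nonneg[of \<kappa>]) auto
    moreover have "((\<kappa> * coef1 n Da L) \<cdot>\<^sub>m e1e1T n) *\<^sub>v e s \<in> carrier_vec n"
      by (rule mult_mat_vec_carrier[OF _ ec]) (simp add: e1e1T_def)
    ultimately show "((\<kappa> * coef1 n Da L) \<cdot>\<^sub>m e1e1T n) *\<^sub>v e s \<in> nonneg_cone n"
      unfolding nonneg_cone_iff by simp
  qed (use x0 init \<open>t \<ge> 0\<close> in auto)
qed

end
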